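(* Let $f\in\mathbb{C}[x,y]$ be a nonzero binary form of degree $d$, with Waring rank $\operatorname{rank} f$ and cactus rank $\operatorname{crank} f$. (1) If $\operatorname{rank} f\le \frac{d+2}{2}$, then $\operatorname{crank} f=\operatorname{rank} f$. (2) If $\operatorname{rank} f> \frac{d+2}{2}$, then $\operatorname{crank} f=d+2-\operatorname{rank} f$.
   Context: The Waring rank $\operatorname{rank} f$ of a nonzero binary form $f$ of degree $d$ is the minimal $r$ such that $f=\ell_1^d+\cdots+\ell_r^d$ with $\ell_j\in\mathbb{C}[x,y]$ linear forms. Let $Q=\mathbb{C}[X,Y]$ with $X=\partial_x$, $Y=\partial_y$, the ring of constant-coefficient differential operators, acting on $\mathbb{C}[x,y]$ by differentiation. The apolar ideal of $f$ is $\operatorname{Ann}(f)=\{q\in Q: q\cdot f=0\}$, a graded ideal of $Q$. The cactus rank $\operatorname{crank} f$ is the minimal length of a $0$-dimensional subscheme $\Gamma$ of $\mathbb{P}^1=\mathbb{P}(Q_1)$ (here $Q_1$ is the space of linear forms in $Q$) defined by a homogeneous ideal $I_\Gamma\subset Q$ with $I_\Gamma\subset\operatorname{Ann}(f)$. Here such a $\Gamma$ is defined by a principal ideal $I_\Gamma=(g)$ with $g\in Q$ a nonzero homogeneous polynomial, and its length is $\deg g$.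
   Formalization: The degree d is assumed to be at least 1: for d = 0 the Waring rank of a constant is undefined unless it is a positive integer, and f = 2 has rank 2 and cactus rank 1, contradicting (2). *)

theory Defs
  imports Complex_Main "HOL-Computational_Algebra.Polynomial"
begin

text \<open>
  The polynomial ring \<open>\<complex>[x,y]\<close> is represented as \<open>\<complex>[y][x]\<close>: \<open>coeff (coeff p i) j\<close> is the coefficient of
  \<open>x^i y^j\<close>. The ring \<open>\<complex>[X,Y]\<close> of differential operators uses the same type, with \<open>X\<close>, \<open>Y\<close> in place
  of \<open>x\<close>, \<open>y\<close>.
\<close>

type_synonym bipoly = "complex poly poly"

text \<open>The zero polynomial is homogeneous of every degree.\<close>

definition homogeneous :: "nat \<Rightarrow> bipoly \<Rightarrow> bool" where
  "homogeneous d p \<longleftrightarrow> (\<forall>i j. coeff (coeff p i) j \<noteq> 0 \<longrightarrow> i + j = d)"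

definition partial_x :: "bipoly \<Rightarrow> bipoly" where
  "partial_x p = pderiv p"

definition partial_y :: "bipoly \<Rightarrow> bipoly" where
  "partial_y p = map_poly pderiv p"

definition diff_action :: "bipoly \<Rightarrow> bipoly \<Rightarrow> bipoly" where
  "diff_action q f =
     (\<Sum>i\<le>degree q. \<Sum>j\<le>degree (coeff q i).
        smult [:coeff (coeff q i) j:] ((partial_x ^^ i) ((partial_y ^^ j) f)))"

definition apolar_ideal :: "bipoly \<Rightarrow> bipoly set" where
  "apolar_ideal f = {q. diff_action q f = 0}"

definition principal_ideal :: "bipoly \<Rightarrow> bipoly set" where
  "principal_ideal g = {q * g | q. True}"

text \<open>
  The degree \<open>d\<close> of the form is an explicit argument. For \<open>d = 0\<close> all summands are \<open>1\<close>, so the notion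
  is only meaningful for \<open>d \<ge> 1\<close>, where every form of degree \<open>d\<close> has such a decomposition.
\<close>

definition waring_rank :: "nat \<Rightarrow> bipoly \<Rightarrow> nat" where
  "waring_rank d f =
     (LEAST r. \<exists>l :: nat \<Rightarrow> bipoly. (\<forall>j<r. homogeneous 1 (l j)) \<and> f = (\<Sum>j<r. l j ^ d))"

text \<open>
  A \<open>0\<close>-dimensional (possibly empty) subscheme of the projective line is given by a principal ideal
  generated by a nonzero homogeneous \<open>g\<close>, and its length is the degree \<open>n\<close> of \<open>g\<close>.
\<close>

definition cactus_rank :: "bipoly \<Rightarrow> nat" where
  "cactus_rank f =
     (LEAST n. \<exists>g. g \<noteq> 0 \<and> homogeneous n g \<and> principal_ideal g \<subseteq> apolar_ideal f)"

end

theory Submission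
  imports Defs "HOL-Computational_Algebra.Fundamental_Theorem_Algebra"
begin

text \<open>
  Write \<open>f = \<Sum>k\<le>d. (d choose k) a\<^sub>k x^k y^(d-k)\<close>. A form \<open>\<Sum>i\<le>n. p\<^sub>i X^i Y^(n-i)\<close> is apolar to \<open>f\<close> iff
  the Hankel equations \<open>\<Sum>i. p\<^sub>i a(m+i) = 0\<close> hold for \<open>m + n \<le> d\<close>, and Waring decompositions of \<open>f\<close> are
  expressions of \<open>a\<close> as power sums, a node at infinity contributing only to \<open>a\<^sub>d\<close>. Let \<open>n\<close> be the
  cactus rank, \<open>P\<close> an apolar form of degree \<open>n\<close> and \<open>r\<close> the Waring rank. Counting equations gives
  \<open>2n \<le> d + 2\<close>, and the product of the linear forms dual to the nodes gives \<open>n \<le> r\<close>. If \<open>r + n \<le> d + 1\<close>,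
  the \<open>d\<close>-th powers in a decomposition of length \<open>r\<close> stay independent after applying \<open>P\<close>, so all nodes are
  roots of \<open>P\<close> and \<open>r \<le> n\<close>. Finally \<open>r \<le> d + 2 - n\<close>: by minimality of \<open>n\<close> the apolar forms of degree
  \<open>d + 2 - n\<close> have no common zero, so a Bertini argument on a pencil of them yields a squarefree one.
\<close>

subsection \<open>Sequences as functionals on polynomials\<close>

definition pairing :: "(nat \<Rightarrow> 'a::comm_ring_1) \<Rightarrow> 'a poly \<Rightarrow> 'a" where
  "pairing a p = (\<Sum>i\<le>degree p. coeff p i * a i)"

lemma pairing_eq_sum:
  assumes "degree p \<le> n"
  shows "pairing a p = (\<Sum>i\<le>n. coeff p i * a i)"
  unfolding pairing_def using assms
  by (intro sum.mono_neutral_left) (auto simp: coeff_eq_0)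

lemma pairing_0 [simp]: "pairing a 0 = 0"
  by (simp add: pairing_def)

lemma pairing_add: "pairing a (p + q) = pairing a p + pairing a q"
proof -
  let ?n = "max (degree p) (degree q)"
  have "degree (p + q) \<le> ?n" by (rule degree_add_le_max)
  then show ?thesis
    by (simp add: pairing_eq_sum[of _ ?n] sum.distrib algebra_simps)
qed

lemma pairing_smult: "pairing a (smult c p) = c * pairing a p"
  by (simp only: pairing_eq_sum[OF degree_smult_le] pairing_def[of a p])
    (simp add: sum_distrib_left mult.assoc)

lemma pairing_minus: "pairing a (- p) = - pairing a p"
  using pairing_smult[of a "-1" p] by simp

lemma pairing_diff: "pairing a (p - q) = pairing a p - pairing a q"
  using pairing_add[of a p "- q"] by (simp add: pairing_minus)

lemma pairing_pCons: "pairing a (pCons c p) = c * a 0 + pairing (\<lambda>i. a (Suc i)) p"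
  by (simp add: pairing_eq_sum[of "pCons c p" "Suc (degree p)"] degree_pCons_le
      sum.atMost_Suc_shift pairing_def del: sum.atMost_Suc)

lemma pairing_sequence_linear:
  "pairing (\<lambda>i. a i + c * b i) p = pairing a p + c * pairing b p"
  by (simp add: pairing_def sum.distrib sum_distrib_left algebra_simps)

lemma pairing_sequence_sum:
  "pairing (\<lambda>i. \<Sum>z\<in>Z. c z * b z i) p = (\<Sum>z\<in>Z. c z * pairing (b z) p)"
  unfolding pairing_def sum_distrib_left
  by (subst sum.swap) (simp add: mult_ac)

lemma pairing_power: "pairing (\<lambda>i. z ^ i) p = poly p z"
  by (simp add: pairing_def poly_altdef)

lemma pairing_delta: "pairing (\<lambda>i. if i = n then e else 0) p = e * coeff p n"
  by (auto simp: pairing_def if_distrib sum.delta coeff_eq_0 cong: if_cong)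

lemma pairing_monom: "pairing a (monom c n) = c * a n"
  by (induction n arbitrary: a) (simp_all add: monom_0 monom_Suc pairing_pCons)

lemma pairing_monom_mult: "pairing a (monom 1 m * p) = pairing (\<lambda>i. a (m + i)) p"
  by (induction m arbitrary: a) (simp_all add: monom_0 monom_Suc pairing_pCons)

text \<open>Multiplying by the variable shifts \<open>a\<close> by one, so each coefficient of
  \<open>q\<close> contributes a shifted pairing with \<open>p\<close>, and the shifts run only up
  to \<open>degree q \<le> d - n\<close>.\<close>

lemma pairing_mult_eq_0:
  assumes "\<And>m. m + n \<le> d \<Longrightarrow> pairing (\<lambda>i. a (m + i)) p = 0"
    and "n + degree q \<le> d"
  shows "pairing a (p * q) = 0"
  using assms
proof (induction q arbitrary: a d)
  case 0
  then show ?case by simp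
next
  case (pCons c q)
  have 1: "pairing a p = 0"
    using pCons.prems(1)[of 0] pCons.prems(2) by simp
  have "pairing (\<lambda>i. a (Suc i)) (p * q) = 0"
  \<comment> \<open>\<open>degree (pCons c 0)\<close> equals \<open>degree 0\<close>, so for
    \<open>q = 0\<close> the bound with \<open>d - 1\<close> can fail; the product is then
    zero.\<close>
  proof (cases "q = 0")
    case False
    then have "n + degree q \<le> d - 1" "d > 0"
      using pCons.prems(2) by auto
    moreover have "pairing (\<lambda>i. a (Suc (m + i))) p = 0" if "m + n \<le> d - 1" for m
      using pCons.prems(1)[of "Suc m"] that \<open>d > 0\<close> by simp
    ultimately show ?thesis by (intro pCons.IH[of "d - 1"])
  qed simp
  then show ?case
    using 1 by (simp add: mult_pCons_right pairing_add pairing_smult pairing_pCons)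
qed

section \<open>Linear algebra of finitely many functionals\<close>

text \<open>Gaussian elimination: at most \<open>n\<close> equations in \<open>n + 1\<close>
  coefficients, the constant coefficient being eliminated first.\<close>

lemma exists_poly_pairing_eq_0:
  fixes \<phi> :: "'i \<Rightarrow> nat \<Rightarrow> 'a::field"
  assumes "finite I" "card I \<le> n"
  shows "\<exists>p. p \<noteq> 0 \<and> degree p \<le> n \<and> (\<forall>i\<in>I. pairing (\<phi> i) p = 0)"
  using assms
proof (induction n arbitrary: I \<phi>)
  case 0
  then show ?case by (intro exI[of _ 1]) auto
next
  case (Suc n)
  show ?case
  proof (cases "\<forall>i\<in>I. \<phi> i 0 = 0")
    case True
    then show ?thesis by (intro exI[of _ 1]) (auto simp: one_pCons pairing_pCons)
  next
    case False
    then obtain j where j: "j \<in> I" "\<phi> j 0 \<noteq> 0" by blast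
    \<comment> \<open>Row operations with pivot row \<open>j\<close> clear the constant coefficient
      from the other equations; row \<open>j\<close> then determines it.\<close>
    let ?\<psi> = "\<lambda>i k. \<phi> i (Suc k) + (- (\<phi> i 0 / \<phi> j 0)) * \<phi> j (Suc k)"
    have "finite (I - {j})" "card (I - {j}) \<le> n"
      using Suc.prems j by auto
    from Suc.IH[OF this, of ?\<psi>] obtain q where
      q: "q \<noteq> 0" "degree q \<le> n" "\<And>i. i \<in> I - {j} \<Longrightarrow> pairing (?\<psi> i) q = 0" by blast
    let ?p = "pCons (- pairing (\<lambda>k. \<phi> j (Suc k)) q / \<phi> j 0) q"
    have "pairing (\<phi> i) ?p = 0" if "i \<in> I" for i
    proof (cases "i = j")
      case True
      then show ?thesis using j by (simp add: pairing_pCons)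
    next
      case False
      with q(3)[of i] that show ?thesis
        unfolding pairing_sequence_linear by (simp add: pairing_pCons field_simps)
    qed
    then show ?thesis
      using q by (intro exI[of _ ?p]) (auto simp: degree_pCons_eq)
  qed
qed

text \<open>Induction on the functionals: restrict to the kernel of one, then choose its coefficient
  so that the identity also holds at a vector \<open>v\<close> outside that kernel.\<close>

lemma pairing_in_span_if_vanishes_on_kernel:
  fixes \<phi> :: "'i \<Rightarrow> nat \<Rightarrow> 'a::field"
  assumes "finite I"
    and "\<And>p q. p \<in> S \<Longrightarrow> q \<in> S \<Longrightarrow> p + q \<in> S" "\<And>c p. p \<in> S \<Longrightarrow> smult c p \<in> S"
    and "\<And>p. p \<in> S \<Longrightarrow> (\<And>i. i \<in> I \<Longrightarrow> pairing (\<phi> i) p = 0) \<Longrightarrow> pairing \<psi> p = 0"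
  shows "\<exists>c. \<forall>p\<in>S. pairing \<psi> p = (\<Sum>i\<in>I. c i * pairing (\<phi> i) p)"
  using assms
proof (induction I arbitrary: S rule: finite_induct)
  case empty
  then show ?case by simp
next
  case (insert j I)
  let ?S = "{p \<in> S. pairing (\<phi> j) p = 0}"
  have "\<exists>c. \<forall>p\<in>?S. pairing \<psi> p = (\<Sum>i\<in>I. c i * pairing (\<phi> i) p)"
  proof (rule insert.IH)
    show "pairing \<psi> p = 0" if "p \<in> ?S" "\<And>i. i \<in> I \<Longrightarrow> pairing (\<phi> i) p = 0" for p
      using that by (intro insert.prems(3)) auto
  qed (use insert.prems(1,2) in \<open>auto simp: pairing_add pairing_smult\<close>)
  then obtain c where c: "\<And>p. p \<in> ?S \<Longrightarrow> pairing \<psi> p = (\<Sum>i\<in>I. c i * pairing (\<phi> i) p)"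
    by blast
  show ?case
  proof (cases "?S = S")
    case True
    show ?thesis
    proof (intro exI ballI)
      fix p assume "p \<in> S"
      with True have "p \<in> ?S" by simp
      then show "pairing \<psi> p = (\<Sum>i\<in>insert j I. c i * pairing (\<phi> i) p)"
        using c insert.hyps by auto
    qed
  next
    case False
    then obtain v where v: "v \<in> S" "pairing (\<phi> j) v \<noteq> 0" by blast
    define e where "e = (pairing \<psi> v - (\<Sum>i\<in>I. c i * pairing (\<phi> i) v)) / pairing (\<phi> j) v"
    have "pairing \<psi> p = (\<Sum>i\<in>I. c i * pairing (\<phi> i) p) + e * pairing (\<phi> j) p"
      if "p \<in> S" for p
    proof -
      define t where "t = pairing (\<phi> j) p / pairing (\<phi> j) v"
      let ?q = "p + smult (- t) v"
      have "?q \<in> ?S"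
        using v that insert.prems(1,2) by (simp add: pairing_add pairing_smult t_def
            del: smult_minus_left)
      from c[OF this] have "pairing \<psi> p - t * pairing \<psi> v =
          (\<Sum>i\<in>I. c i * pairing (\<phi> i) p) - t * (\<Sum>i\<in>I. c i * pairing (\<phi> i) v)"
        by (simp add: pairing_diff pairing_add pairing_smult pairing_minus algebra_simps
            sum_subtractf sum_distrib_left)
      moreover have "t * (pairing \<psi> v - (\<Sum>i\<in>I. c i * pairing (\<phi> i) v)) = e * pairing (\<phi> j) p"
        using v by (simp add: t_def e_def)
      ultimately show ?thesis by (simp add: algebra_simps)
    qed
    then show ?thesis
      using insert.hyps
      by (intro exI[of _ "c(j := e)"]) (auto simp: add.commute intro!: sum.cong)
  qed
qed

text \<open>A vector space over an infinite field is not a finite union of proper subspaces: on the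
  line \<open>v + smult t w\<close>, each functional excludes at most one \<open>t\<close>.\<close>

lemma exists_common_pairing_neq_0:
  fixes \<Phi> :: "(nat \<Rightarrow> 'a::field_char_0) set"
  assumes "finite \<Phi>" "0 \<in> S"
    and add: "\<And>p q. p \<in> S \<Longrightarrow> q \<in> S \<Longrightarrow> p + q \<in> S"
    and smult: "\<And>c p. p \<in> S \<Longrightarrow> smult c p \<in> S"
    and "\<And>\<phi>. \<phi> \<in> \<Phi> \<Longrightarrow> \<exists>p\<in>S. pairing \<phi> p \<noteq> 0"
  shows "\<exists>p\<in>S. \<forall>\<phi>\<in>\<Phi>. pairing \<phi> p \<noteq> 0"
  using assms(1,5)
proof (induction \<Phi> rule: finite_induct)
  case empty
  then show ?case using assms(2) by blast
next
  case (insert \<psi> \<Phi>)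
  then obtain v where v: "v \<in> S" "\<And>\<phi>. \<phi> \<in> \<Phi> \<Longrightarrow> pairing \<phi> v \<noteq> 0" by blast
  obtain w where w: "w \<in> S" "pairing \<psi> w \<noteq> 0" using insert.prems by blast
  let ?B = "insert (- pairing \<psi> v / pairing \<psi> w) ((\<lambda>\<phi>. - pairing \<phi> v / pairing \<phi> w) ` \<Phi>)"
  obtain t where t: "t \<notin> ?B"
    using insert.hyps ex_new_if_finite[of ?B] infinite_UNIV_char_0 by blast
  have "pairing \<phi> (v + smult t w) \<noteq> 0" if "\<phi> \<in> insert \<psi> \<Phi>" for \<phi>
  proof (cases "pairing \<phi> w = 0")
    case True
    then show ?thesis using that v w by (auto simp: pairing_add pairing_smult)
  next
    case False
    have "t \<noteq> - pairing \<phi> v / pairing \<phi> w" using t that by blast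
    with False show ?thesis
      by (simp add: pairing_add pairing_smult field_simps eq_neg_iff_add_eq_0)
  qed
  moreover have "v + smult t w \<in> S" using v w add smult by blast
  ultimately show ?case by blast
qed

subsection \<open>Hankel kernels and power sums\<close>

text \<open>Apolar forms of degree \<open>n\<close> with \<open>Y = 1\<close>. Here \<open>n\<close>
  is a formal degree: for nonzero \<open>p\<close>, \<open>degree p < n\<close> encodes a zero at
  infinity.\<close>

definition hankel_kernel :: "nat \<Rightarrow> (nat \<Rightarrow> 'a::comm_ring_1) \<Rightarrow> nat \<Rightarrow> 'a poly set" where
  "hankel_kernel d a n =
     {p. degree p \<le> n \<and> (\<forall>m. m + n \<le> d \<longrightarrow> pairing (\<lambda>i. a (m + i)) p = 0)}"

text \<open>\<open>e\<close> is the weight of the node at infinity; it costs one term when nonzero.\<close>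

definition power_sum_rep :: "nat \<Rightarrow> (nat \<Rightarrow> 'a::field) \<Rightarrow> nat \<Rightarrow> bool" where
  "power_sum_rep d a r \<longleftrightarrow> (\<exists>Z c e. finite Z \<and> card Z + (if e = 0 then 0 else 1) \<le> r \<and>
     (\<forall>k\<le>d. a k = (\<Sum>z\<in>Z. c z * z ^ k) + (if k = d then e else 0)))"

lemma hankel_kernel_closed:
  shows zero_in_hankel_kernel: "0 \<in> hankel_kernel d a n"
    and add_in_hankel_kernel:
      "p \<in> hankel_kernel d a n \<Longrightarrow> q \<in> hankel_kernel d a n \<Longrightarrow> p + q \<in> hankel_kernel d a n"
    and smult_in_hankel_kernel: "p \<in> hankel_kernel d a n \<Longrightarrow> smult c p \<in> hankel_kernel d a n"
  by (auto simp: hankel_kernel_def pairing_add pairing_smult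
      intro: degree_add_le order.trans[OF degree_smult_le])

lemma pairing_mult_hankel_kernel:
  assumes "p \<in> hankel_kernel d a n" "n + degree q \<le> d"
  shows "pairing a (p * q) = 0"
  using assms by (intro pairing_mult_eq_0[of n d]) (auto simp: hankel_kernel_def)

text \<open>The ideal property of apolar forms: shifting \<open>a\<close> by \<open>m\<close> is
  multiplying the test polynomial by \<open>monom 1 m\<close>. Slack in
  \<open>n + degree q \<le> s\<close> amounts to extra zeros at infinity.\<close>

lemma hankel_kernel_mult:
  assumes "p \<in> hankel_kernel d a n" "n + degree q \<le> s"
  shows "p * q \<in> hankel_kernel d a s"
proof -
  have "pairing (\<lambda>i. a (m + i)) (p * q) = 0" if "m + s \<le> d" for m
  proof -
    have "degree (monom 1 m * q) \<le> m + degree q"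
      by (metis degree_mult_le degree_monom_le add_le_mono1 order.trans)
    then have "pairing a (p * (monom 1 m * q)) = 0"
      using assms that by (intro pairing_mult_hankel_kernel) auto
    then show ?thesis by (simp add: mult.left_commute[of p] pairing_monom_mult)
  qed
  moreover have "degree (p * q) \<le> s"
    using assms degree_mult_le[of p q] by (auto simp: hankel_kernel_def)
  ultimately show ?thesis by (auto simp: hankel_kernel_def)
qed

text \<open>There are \<open>d + 1 - n \<le> n\<close> equations for \<open>n + 1\<close>
  coefficients.\<close>

lemma hankel_kernel_nontrivial:
  fixes a :: "nat \<Rightarrow> 'a::field"
  assumes "d + 1 \<le> 2 * n"
  shows "\<exists>p\<in>hankel_kernel d a n. p \<noteq> 0"
proof -
  have "{m. m + n \<le> d} \<subseteq> {..<d + 1 - n}" by auto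
  then have "finite {m. m + n \<le> d}" "card {m. m + n \<le> d} \<le> n"
    using assms card_mono[of "{..<d + 1 - n}" "{m. m + n \<le> d}"] by (auto intro: finite_subset)
  from exists_poly_pairing_eq_0[OF this, of "\<lambda>m i. a (m + i)"]
  show ?thesis by (auto simp: hankel_kernel_def)
qed

text \<open>The coefficient at \<open>d\<close> is the value at infinity of a form of degree
  \<open>d\<close>, so all nodes act by evaluation.\<close>

lemma pairing_power_sum:
  fixes a :: "nat \<Rightarrow> 'a::field"
  assumes "\<And>k. k \<le> d \<Longrightarrow> a k = (\<Sum>z\<in>Z. c z * z ^ k) + (if k = d then e else 0)"
    and "degree q \<le> d"
  shows "pairing a q = (\<Sum>z\<in>Z. c z * poly q z) + e * coeff q d"
proof -
  have "pairing a q =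
      pairing (\<lambda>k. (\<Sum>z\<in>Z. c z * z ^ k) + 1 * (if k = d then e else 0)) q"
    unfolding pairing_def by (intro sum.cong) (use assms in auto)
  also have "\<dots> = (\<Sum>z\<in>Z. c z * poly q z) + e * coeff q d"
    unfolding pairing_sequence_linear pairing_sequence_sum pairing_power pairing_delta by simp
  finally show ?thesis .
qed

lemma prod_linear_factors:
  fixes Z :: "'a::idom set"
  shows "degree (\<Prod>z\<in>Z. [:- z, 1:]) = card Z" "(\<Prod>z\<in>Z. [:- z, 1:]) \<noteq> 0"
    "coeff (\<Prod>z\<in>Z. [:- z, 1:]) (card Z) = 1"
proof -
  show 1: "degree (\<Prod>z\<in>Z. [:- z, 1:]) = card Z"
    by (subst degree_prod_sum_eq) auto
  show 2: "coeff (\<Prod>z\<in>Z. [:- z, 1:]) (card Z) = 1"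
    using lead_coeff_prod[of "\<lambda>z. [:- z, 1:]" Z] by (simp add: 1)
  then show "(\<Prod>z\<in>Z. [:- z, 1:]) \<noteq> 0" by auto
qed

text \<open>The polynomial with a simple root at each finite node works; a node at infinity shows
  only in the gap between \<open>card Z\<close> and \<open>r\<close>.\<close>

lemma power_sum_rep_imp_hankel_kernel:
  fixes a :: "nat \<Rightarrow> 'a::field"
  assumes "power_sum_rep d a r"
  shows "\<exists>p\<in>hankel_kernel d a r. p \<noteq> 0"
proof -
  obtain Z c e where Z: "finite Z" "card Z + (if e = 0 then 0 else 1) \<le> r"
    and a: "\<And>k. k \<le> d \<Longrightarrow> a k = (\<Sum>z\<in>Z. c z * z ^ k) + (if k = d then e else 0)"
    using assms unfolding power_sum_rep_def by blast
  let ?p = "\<Prod>z\<in>Z. [:- z, 1:]"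
  have "pairing (\<lambda>i. a (m + i)) ?p = 0" if "m + r \<le> d" for m
  proof -
    have deg: "degree (monom 1 m * ?p) = m + card Z"
      using prod_linear_factors[of Z] by (simp add: degree_mult_eq degree_monom_eq)
    have "pairing a (monom 1 m * ?p) =
        (\<Sum>z\<in>Z. c z * poly (monom 1 m * ?p) z) + e * coeff (monom 1 m * ?p) d"
      by (rule pairing_power_sum[OF a]) (use that Z deg in auto)
    also have "(\<Sum>z\<in>Z. c z * poly (monom 1 m * ?p) z) = 0"
      using Z by (intro sum.neutral) (auto simp: poly_prod)
    \<comment> \<open>For \<open>e \<noteq> 0\<close> the node at infinity takes one unit of
      \<open>r\<close>, so the degree stays below \<open>d\<close>.\<close>
    also have "e * coeff (monom 1 m * ?p) d = 0"
      using Z(2) that deg by (cases "e = 0") (auto intro!: coeff_eq_0)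
    finally show ?thesis by (simp add: pairing_monom_mult)
  qed
  then show ?thesis
    using prod_linear_factors[of Z] Z(2) by (intro bexI[of _ ?p]) (auto simp: hankel_kernel_def)
qed

text \<open>Testing against the products of all linear factors but one, whose degree is small enough
  because \<open>r + n \<le> d + 1\<close>, shows that every node of the representation is a root of \<open>p\<close>.\<close>

lemma power_sum_rep_reduce:
  fixes a :: "nat \<Rightarrow> 'a::field"
  assumes "power_sum_rep d a r" and p: "p \<in> hankel_kernel d a n" "p \<noteq> 0"
    and "r + n \<le> d + 1" "n \<le> d"
  shows "power_sum_rep d a n"
proof -
  obtain Z0 c e where Z0: "finite Z0" "card Z0 + (if e = 0 then 0 else 1) \<le> r"
    and a0: "\<And>k. k \<le> d \<Longrightarrow> a k = (\<Sum>z\<in>Z0. c z * z ^ k) + (if k = d then e else 0)"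
    using assms(1) unfolding power_sum_rep_def by blast
  \<comment> \<open>Nodes of weight zero are dropped, so that weights can be cancelled
    below.\<close>
  define Z where "Z = {z \<in> Z0. c z \<noteq> 0}"
  have Z: "finite Z" "card Z + (if e = 0 then 0 else 1) \<le> r" "\<And>z. z \<in> Z \<Longrightarrow> c z \<noteq> 0"
    using Z0 card_mono[of Z0 Z] by (auto simp: Z_def)
  have a: "a k = (\<Sum>z\<in>Z. c z * z ^ k) + (if k = d then e else 0)" if "k \<le> d" for k
  proof -
    have "(\<Sum>z\<in>Z. c z * z ^ k) = (\<Sum>z\<in>Z0. c z * z ^ k)"
      using Z0 by (intro sum.mono_neutral_left) (auto simp: Z_def)
    then show ?thesis using a0[OF that] by simp
  qed
  have deg_p: "degree p \<le> n" using p by (simp add: hankel_kernel_def)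
  have vanish: "(\<Sum>z\<in>Z. c z * poly (p * q) z) + e * coeff (p * q) d = 0" if "n + degree q \<le> d" for q
  proof -
    have "degree (p * q) \<le> d" using that deg_p degree_mult_le[of p q] by linarith
    from pairing_power_sum[OF a this] pairing_mult_hankel_kernel[OF p(1) that]
    show ?thesis by simp
  qed
  have root: "poly p z = 0" if z: "z \<in> Z" for z
  proof -
    let ?q = "\<Prod>w\<in>Z - {z}. [:- w, 1:]"
    have card: "card Z = Suc (card (Z - {z}))" using z Z(1) by (metis card_Suc_Diff1)
    have deg_q: "degree ?q = card (Z - {z})" by (rule prod_linear_factors)
    \<comment> \<open>The unit saved for \<open>e \<noteq> 0\<close> keeps \<open>p * ?q\<close>
      below degree \<open>d\<close>, which removes the contribution of infinity.\<close>
    have deg: "n + degree ?q + (if e = 0 then 0 else 1) \<le> d"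
      using card Z(2) assms(4) unfolding deg_q by auto
    have "e * coeff (p * ?q) d = 0"
      using deg deg_p degree_mult_le[of p ?q] by (cases "e = 0") (auto intro!: coeff_eq_0)
    moreover have "(\<Sum>w\<in>Z. c w * poly (p * ?q) w) = (\<Sum>w\<in>{z}. c w * poly (p * ?q) w)"
      using Z(1) z by (intro sum.mono_neutral_right) (auto simp: poly_prod)
    ultimately have "c z * poly (p * ?q) z = 0"
      using vanish[of ?q] deg by auto
    moreover have "poly ?q z \<noteq> 0" using Z(1) by (auto simp: poly_prod)
    ultimately show ?thesis using Z(3)[OF z] by simp
  qed
  have card_Z: "card Z \<le> degree p"
    using root p card_poly_roots_bound[of p] poly_roots_finite[of p]
      card_mono[of "{x. poly p x = 0}" Z] by fastforce
  \<comment> \<open>Infinity is a zero of \<open>p\<close> too: the test polynomial kills all finite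
    nodes and is padded to degree exactly \<open>d - n\<close>, so the coefficient at
    \<open>d\<close> of the product is \<open>coeff p n\<close>.\<close>
  have "coeff p n = 0" if "e \<noteq> 0"
  proof -
    define k where "k = d - n - card Z"
    let ?q = "monom 1 k * (\<Prod>w\<in>Z. [:- w, 1:])"
    have k: "k + card Z = d - n" using Z(2) that assms(4) by (auto simp: k_def)
    have deg_q: "degree ?q = d - n"
      using prod_linear_factors[of Z] k by (simp add: degree_mult_eq degree_monom_eq)
    have lead_q: "coeff ?q (d - n) = 1"
      using prod_linear_factors(3)[of Z] k by (simp add: coeff_monom_mult flip: k)
    have "(\<Sum>w\<in>Z. c w * poly (p * ?q) w) = 0"
      using Z(1) by (intro sum.neutral) (auto simp: poly_prod)
    then have "coeff (p * ?q) d = 0"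
      using vanish[of ?q] that deg_q assms(5) by simp
    moreover have "coeff (p * ?q) (n + (d - n)) = coeff p n * coeff ?q (d - n)"
    proof (cases "degree p = n")
      case True
      then show ?thesis using coeff_mult_degree_sum[of p ?q] deg_q by simp
    next
      case False
      then have "degree p < n" using deg_p by simp
      moreover from this have "degree (p * ?q) < d"
        using degree_mult_le[of p ?q] deg_q assms(5) by linarith
      ultimately show ?thesis using assms(5) by (simp add: coeff_eq_0)
    qed
    ultimately show ?thesis using lead_q assms(5) by simp
  qed
  then have "e \<noteq> 0 \<Longrightarrow> degree p < n"
    using deg_p p(2) by (metis le_neq_implies_less leading_coeff_0_iff)
  then have "card Z + (if e = 0 then 0 else 1) \<le> n" using card_Z deg_p by auto
  then show ?thesis unfolding power_sum_rep_def using Z(1) a by blast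
qed

section \<open>Complementary degrees: common zeros and squarefree apolar polynomials\<close>

text \<open>The kernel is cut out by \<open>k\<close> Hankel equations, so \<open>\<psi>\<close> is
  a combination of them; its coefficients are collected in the polynomial \<open>p\<close>.\<close>

lemma functional_vanishing_on_hankel_kernel:
  fixes a :: "nat \<Rightarrow> 'a::field"
  assumes "\<And>v. v \<in> hankel_kernel d a s \<Longrightarrow> pairing \<psi> v = 0" and "k + s = d + 1"
  shows "\<exists>p. (p = 0 \<or> degree p < k) \<and> (\<forall>v. degree v \<le> s \<longrightarrow> pairing \<psi> v = pairing a (p * v))"
proof -
  have "\<exists>c. \<forall>v\<in>{v. degree v \<le> s}. pairing \<psi> v = (\<Sum>m<k. c m * pairing (\<lambda>i. a (m + i)) v)"
  proof (rule pairing_in_span_if_vanishes_on_kernel)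
    fix v assume "v \<in> {v. degree v \<le> s}" "\<And>m. m \<in> {..<k} \<Longrightarrow> pairing (\<lambda>i. a (m + i)) v = 0"
    then have "v \<in> hankel_kernel d a s" using assms(2) by (auto simp: hankel_kernel_def)
    then show "pairing \<psi> v = 0" by (rule assms(1))
  qed (auto intro: degree_add_le order.trans[OF degree_smult_le])
  then obtain c where
    c: "\<And>v. degree v \<le> s \<Longrightarrow> pairing \<psi> v = (\<Sum>m<k. c m * pairing (\<lambda>i. a (m + i)) v)"
    by blast
  let ?p = "\<Sum>m<k. monom (c m) m"
  have "pairing a (?p * v) = (\<Sum>m<k. c m * pairing (\<lambda>i. a (m + i)) v)" for v
  proof (induction k)
    case (Suc k)
    have "monom (c k) k * v = smult (c k) (monom 1 k * v)" by (simp add: smult_monom flip: mult_smult_left)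
    then show ?case
      using Suc by (simp add: distrib_right pairing_add pairing_smult pairing_monom_mult)
  qed simp
  moreover have "?p = 0 \<or> degree ?p < k"
  proof (cases "k = 0")
    case False
    have "degree ?p \<le> k - 1"
      by (intro degree_sum_le) (auto intro: order.trans[OF degree_monom_le])
    with False show ?thesis by auto
  qed simp
  ultimately show ?thesis using c by (intro exI[of _ ?p] conjI allI impI) simp_all
qed

text \<open>If all kernel elements vanished at \<open>z\<close>, evaluation at \<open>z\<close>
  would be \<open>pairing a (p * v)\<close>. Multiples of \<open>[:- z, 1:]\<close> evaluate to
  zero, so \<open>[:- z, 1:] * p\<close> lies in the trivial kernel of degree \<open>k\<close>; then
  \<open>p = 0\<close>, although evaluating \<open>1\<close> gives \<open>1\<close>.\<close>

lemma hankel_kernel_base_point_free: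
  fixes a :: "nat \<Rightarrow> 'a::field"
  assumes "hankel_kernel d a k \<subseteq> {0}" and "k + s = d + 1"
  shows "\<exists>v\<in>hankel_kernel d a s. poly v z \<noteq> 0"
proof (rule ccontr)
  assume "\<not> ?thesis"
  then have "pairing (\<lambda>i. z ^ i) v = 0" if "v \<in> hankel_kernel d a s" for v
    using that by (simp add: pairing_power)
  from functional_vanishing_on_hankel_kernel[OF this assms(2)] obtain p where
    p: "p = 0 \<or> degree p < k" "\<And>v. degree v \<le> s \<Longrightarrow> poly v z = pairing a (p * v)"
    unfolding pairing_power by blast
  have "pairing (\<lambda>i. a (m + i)) ([:- z, 1:] * p) = 0" if "m + k \<le> d" for m
  proof -
    have "degree ([:- z, 1:] * monom 1 m) \<le> s"
      using that assms(2) degree_mult_le[of "[:- z, 1:]" "monom 1 m"] by (simp add: degree_monom_eq)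
    from p(2)[OF this] have "pairing a (monom 1 m * ([:- z, 1:] * p)) = 0"
      by (simp only: mult_ac) simp
    then show ?thesis by (simp add: pairing_monom_mult)
  qed
  moreover have "degree ([:- z, 1:] * p) \<le> k"
    using p(1) degree_mult_le[of "[:- z, 1:]" p] by auto
  ultimately have "[:- z, 1:] * p \<in> hankel_kernel d a k" by (simp add: hankel_kernel_def)
  then have "[:- z, 1:] * p = 0" using assms(1) by blast
  then have "p = 0" by (simp del: mult_pCons_left)
  then show False using p(2)[of 1] by simp
qed

text \<open>The analogue at infinity: \<open>coeff v s\<close> is the value there, and the linear
  form vanishing there dehomogenizes to \<open>1\<close>, so \<open>p\<close> itself lies in the
  kernel of degree \<open>k\<close>.\<close>

lemma hankel_kernel_full_degree:
  fixes a :: "nat \<Rightarrow> 'a::field"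
  assumes "hankel_kernel d a k \<subseteq> {0}" and "k + s = d + 1"
  shows "\<exists>v\<in>hankel_kernel d a s. coeff v s \<noteq> 0"
proof (rule ccontr)
  assume "\<not> ?thesis"
  then have "pairing (\<lambda>i. if i = s then 1 else 0) v = 0" if "v \<in> hankel_kernel d a s" for v
    unfolding pairing_delta using that by auto
  from functional_vanishing_on_hankel_kernel[OF this assms(2)] obtain p where
    p: "p = 0 \<or> degree p < k" "\<And>v. degree v \<le> s \<Longrightarrow> coeff v s = pairing a (p * v)"
    unfolding pairing_delta by auto
  have "pairing (\<lambda>i. a (m + i)) p = 0" if "m + k \<le> d" for m
  proof -
    have "pairing a (monom 1 m * p) = 0"
      using p(2)[of "monom 1 m"] that assms(2) by (simp add: degree_monom_eq mult.commute)
    then show ?thesis by (simp add: pairing_monom_mult)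
  qed
  then have "p \<in> hankel_kernel d a k" using p(1) by (auto simp: hankel_kernel_def)
  then have "p = 0" using assms(1) by blast
  then show False using p(2)[of "monom 1 s"] by (simp add: degree_monom_eq)
qed

text \<open>A multiple root of \<open>G + t Q\<close> is a root of the Wronskian of \<open>G\<close> and \<open>Q\<close>, and it determines
  \<open>t\<close> because \<open>G\<close> and \<open>Q\<close> have no common root; so only finitely many \<open>t\<close> are bad.\<close>

lemma pencil_rsquarefree_member:
  fixes G Q :: "complex poly"
  assumes deg: "degree G = s" "degree Q \<le> s" and "s \<ge> 1"
    and coprime: "\<And>z. poly G z = 0 \<Longrightarrow> poly Q z \<noteq> 0"
  shows "\<exists>t. degree (G + smult t Q) = s \<and> rsquarefree (G + smult t Q)"
proof -
  define W where "W = pderiv G * Q - G * pderiv Q"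
  \<comment> \<open>If the two products agreed, so would their orders at a root of \<open>G\<close>;
    but differentiating \<open>G\<close> lowers its order by one, and \<open>Q\<close> does not
    vanish there.\<close>
  have "W \<noteq> 0"
  proof
    assume "W = 0"
    then have eq: "pderiv G * Q = G * pderiv Q" by (simp add: W_def)
    obtain z where z: "poly G z = 0"
      using fundamental_theorem_of_algebra[of G] assms(1,3) by (metis constant_degree not_one_le_zero)
    have "G \<noteq> 0" "pderiv G \<noteq> 0" "Q \<noteq> 0"
      using assms(1,3) coprime[OF z] by (auto simp: pderiv_eq_0_iff)
    then have "pderiv G * Q \<noteq> 0" "G * pderiv Q \<noteq> 0" using eq by auto
    then have "order z (pderiv G) + order z Q = order z G + order z (pderiv Q)"
      using eq by (metis order_mult)
    moreover have "order z Q = 0" using coprime[OF z] by (simp add: order_0I)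
    ultimately show False using order_pderiv[OF \<open>G \<noteq> 0\<close> z] by simp
  qed
  \<comment> \<open>The inserted value guards the leading coefficient, so the degree stays
    \<open>s\<close>.\<close>
  define B where "B = insert (- coeff G s / coeff Q s) ((\<lambda>z. - poly G z / poly Q z) ` {z. poly W z = 0})"
  have "finite B" using poly_roots_finite[OF \<open>W \<noteq> 0\<close>] by (simp add: B_def)
  then obtain t where t: "t \<notin> B"
    using ex_new_if_finite infinite_UNIV_char_0 by blast
  let ?F = "G + smult t Q"
  have "coeff G s \<noteq> 0" using deg(1) assms(3) by auto
  moreover have "t \<noteq> - coeff G s / coeff Q s" using t by (simp add: B_def)
  ultimately have "coeff ?F s \<noteq> 0"
    by (cases "coeff Q s = 0") (auto simp: field_simps eq_neg_iff_add_eq_0)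
  moreover have "degree ?F \<le> s"
    using deg by (intro degree_add_le) (auto intro: order.trans[OF degree_smult_le])
  ultimately have "degree ?F = s" by (meson le_antisym le_degree)
  moreover have "\<not> (poly ?F z = 0 \<and> poly (pderiv ?F) z = 0)" for z
  proof
    assume *: "poly ?F z = 0 \<and> poly (pderiv ?F) z = 0"
    then have F: "poly G z = - t * poly Q z" "poly (pderiv G) z = - t * poly (pderiv Q) z"
      by (auto simp: pderiv_add pderiv_smult eq_neg_iff_add_eq_0)
    then have "poly W z = 0" by (simp add: W_def)
    moreover have "poly Q z \<noteq> 0" using F(1) coprime[of z] by auto
    then have "t = - poly G z / poly Q z" using F(1) by simp
    ultimately have "t \<in> B" unfolding B_def by blast
    with t show False by contradiction
  qed
  ultimately show ?thesis by (auto simp: rsquarefree_roots)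
qed

lemma rsquarefree_card_roots:
  fixes p :: "complex poly"
  assumes "rsquarefree p"
  shows "card {z. poly p z = 0} = degree p"
proof -
  have "p \<noteq> 0" using assms by (auto simp: rsquarefree_def)
  have "degree p = degree (smult (lead_coeff p) (\<Prod>z|poly p z = 0. [:- z, 1:]))"
    using complex_poly_decompose_rsquarefree[OF assms] by simp
  then show ?thesis using \<open>p \<noteq> 0\<close> by (simp add: prod_linear_factors)
qed

text \<open>Sylvester's argument: a polynomial of degree at most \<open>d\<close> vanishing at all
  roots of \<open>F\<close> is a multiple of \<open>F\<close>, hence annihilated by
  \<open>a\<close>; so \<open>a\<close> is a combination of evaluations at these roots.\<close>

lemma hankel_kernel_rsquarefree_imp_power_sum_rep:
  fixes a :: "nat \<Rightarrow> complex"
  assumes F: "F \<in> hankel_kernel d a s" "rsquarefree F" "degree F = s" and "s \<le> d + 1"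
  shows "power_sum_rep d a s"
proof -
  let ?Z = "{z. poly F z = 0}"
  have F0: "F \<noteq> 0" using F(2) by (auto simp: rsquarefree_def)
  have Z: "finite ?Z" "card ?Z = s"
    using poly_roots_finite[OF F0] rsquarefree_card_roots[OF F(2)] F(3) by auto
  have "\<exists>c. \<forall>q\<in>{q. degree q \<le> d}. pairing a q = (\<Sum>z\<in>?Z. c z * pairing (\<lambda>i. z ^ i) q)"
  proof (rule pairing_in_span_if_vanishes_on_kernel)
    fix q assume q: "q \<in> {q. degree q \<le> d}" "\<And>z. z \<in> ?Z \<Longrightarrow> pairing (\<lambda>i. z ^ i) q = 0"
    have "q mod F = 0"
    proof (rule ccontr)
      assume "q mod F \<noteq> 0"
      then have deg: "degree (q mod F) < s" using F0 F(3) degree_mod_less'[of F q] by simp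
      have "poly (q mod F) z = 0" if "z \<in> ?Z" for z
        using q(2)[OF that] that poly_mod[of F z q] by (simp add: pairing_power)
      then have "q mod F = 0"
        using deg Z by (intro poly_eqI_degree[of ?Z]) auto
      with \<open>q mod F \<noteq> 0\<close> show False by simp
    qed
    then obtain h where h: "q = F * h" by (metis mod_eq_0_iff_dvd dvdE)
    show "pairing a q = 0"
    proof (cases "h = 0")
      case False
      then have "s + degree h \<le> d" using q(1) h F0 F(3) by (simp add: degree_mult_eq)
      then show ?thesis unfolding h by (rule pairing_mult_hankel_kernel[OF F(1)])
    qed (simp add: h)
  qed (use Z in \<open>auto intro: degree_add_le order.trans[OF degree_smult_le]\<close>)
  then obtain c where
    c: "\<And>q. degree q \<le> d \<Longrightarrow> pairing a q = (\<Sum>z\<in>?Z. c z * poly q z)"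
    unfolding pairing_power by blast
  have "a k = (\<Sum>z\<in>?Z. c z * z ^ k) + (if k = d then 0 else 0)" if "k \<le> d" for k
    using c[of "monom 1 k"] that by (simp add: pairing_monom degree_monom_eq poly_monom)
  then show ?thesis
    unfolding power_sum_rep_def using Z by (intro exI[of _ ?Z] exI[of _ c] exI[of _ 0]) auto
qed

lemma power_sum_rep_complementary:
  fixes a :: "nat \<Rightarrow> complex"
  assumes P: "P \<in> hankel_kernel d a n" "P \<noteq> 0" and min: "hankel_kernel d a (n - 1) \<subseteq> {0}"
    and "n \<ge> 1" "n \<le> s" "n + s = d + 2"
  shows "power_sum_rep d a s"
proof -
  have ks: "(n - 1) + s = d + 1" using assms by simp
  let ?K = "hankel_kernel d a s"
  \<comment> \<open>Evaluations at the roots of \<open>P\<close>, together with the value at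
    infinity.\<close>
  let ?\<Phi> = "insert (\<lambda>i. if i = s then 1 else 0) ((\<lambda>z i. z ^ i) ` {z. poly P z = 0})"
  have "\<exists>G\<in>?K. \<forall>\<phi>\<in>?\<Phi>. pairing \<phi> G \<noteq> 0"
  proof (rule exists_common_pairing_neq_0)
    show "finite ?\<Phi>" using poly_roots_finite[OF P(2)] by simp
    show "\<exists>p\<in>?K. pairing \<phi> p \<noteq> 0" if "\<phi> \<in> ?\<Phi>" for \<phi>
      using that hankel_kernel_base_point_free[OF min ks] hankel_kernel_full_degree[OF min ks]
      by (auto simp: pairing_power pairing_delta)
  qed (auto intro: hankel_kernel_closed)
  then obtain G where G: "G \<in> ?K" "coeff G s \<noteq> 0" "\<And>z. poly P z = 0 \<Longrightarrow> poly G z \<noteq> 0"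
    by (auto simp: pairing_power pairing_delta)
  have deg_G: "degree G = s"
    using G by (auto simp: hankel_kernel_def intro: le_antisym le_degree)
  have "G \<noteq> 0" using G(2) by auto
  \<comment> \<open>The padding root \<open>c\<close> avoids the roots of \<open>G\<close>, so that
    \<open>Q\<close>, a multiple of \<open>P\<close>, gains no zero in common with
    \<open>G\<close>.\<close>
  from poly_roots_finite[OF this] obtain c where c: "poly G c \<noteq> 0"
    using ex_new_if_finite[of "{z. poly G z = 0}"] infinite_UNIV_char_0 by blast
  define Q where "Q = P * [:- c, 1:] ^ (s - n)"
  have Q: "Q \<in> ?K"
    unfolding Q_def using P(1) assms(5) by (intro hankel_kernel_mult[of _ _ _ n]) (auto simp: degree_power_eq)
  have "poly Q z \<noteq> 0" if "poly G z = 0" for z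
    using that G(3)[of z] c by (auto simp: Q_def)
  moreover have "degree Q \<le> s" using Q by (simp add: hankel_kernel_def)
  ultimately obtain t where t: "degree (G + smult t Q) = s" "rsquarefree (G + smult t Q)"
    using pencil_rsquarefree_member[of G s Q] deg_G assms(4,5) by auto
  have "G + smult t Q \<in> ?K" using G(1) Q by (intro hankel_kernel_closed)
  then show ?thesis
    using t assms(4,6) by (intro hankel_kernel_rsquarefree_imp_power_sum_rep[of "G + smult t Q"]) auto
qed

lemma least_hankel_kernel_and_power_sum_rep:
  fixes a :: "nat \<Rightarrow> complex"
  assumes "d \<ge> 1" and "k \<le> d" "a k \<noteq> 0"
  defines "n \<equiv> (LEAST n. \<exists>p\<in>hankel_kernel d a n. p \<noteq> 0)"
    and "r \<equiv> (LEAST r. power_sum_rep d a r)"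
  shows "2 * n \<le> d + 2 \<and> (r = n \<or> r + n = d + 2)"
proof -
  let ?P = "\<lambda>n. \<exists>p\<in>hankel_kernel d a n. p \<noteq> 0"
  have ex: "\<exists>p\<in>hankel_kernel d a (d div 2 + 1). p \<noteq> 0"
    by (rule hankel_kernel_nontrivial) presburger
  have n_le: "n \<le> d div 2 + 1" unfolding n_def by (rule Least_le[of ?P, OF ex])
  obtain P where P: "P \<in> hankel_kernel d a n" "P \<noteq> 0"
    using LeastI[of ?P, OF ex] unfolding n_def by blast
  \<comment> \<open>A nonzero constant in the kernel would annihilate \<open>a k\<close>. Hence
    \<open>n - 1\<close> really lies below the minimum.\<close>
  have "n \<noteq> 0"
  proof
    assume "n = 0"
    then obtain c where c: "P = [:c:]" using P by (auto simp: hankel_kernel_def elim: degree_eq_zeroE)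
    then have "c * a k = 0"
      using P(1) \<open>n = 0\<close> assms(2) by (auto simp: hankel_kernel_def pairing_pCons)
    with c P(2) assms(3) show False by simp
  qed
  then have "n - 1 < (LEAST n. ?P n)" unfolding n_def[symmetric] by simp
  from not_less_Least[OF this] have min: "hankel_kernel d a (n - 1) \<subseteq> {0}" by blast
  have s: "power_sum_rep d a (d + 2 - n)"
    using \<open>n \<noteq> 0\<close> n_le by (intro power_sum_rep_complementary[OF P min]) auto
  have "r \<le> d + 2 - n" unfolding r_def by (rule Least_le[of "power_sum_rep d a", OF s])
  have rep: "power_sum_rep d a r" unfolding r_def by (rule LeastI[of "power_sum_rep d a", OF s])
  have "n \<le> r" unfolding n_def by (rule Least_le[of ?P, OF power_sum_rep_imp_hankel_kernel[OF rep]])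
  have "r \<le> n" if "r + n \<le> d + 1"
  proof -
    have "n \<le> d" using n_le assms(1) by linarith
    from power_sum_rep_reduce[OF rep P that this] show ?thesis
      unfolding r_def by (rule Least_le)
  qed
  \<comment> \<open>Either \<open>r + n \<le> d + 1\<close>, which gives \<open>r = n\<close>, or
    the upper bound on \<open>r\<close> is attained.\<close>
  then show ?thesis using \<open>n \<le> r\<close> \<open>r \<le> d + 2 - n\<close> n_le by linarith
qed

section \<open>Weighted nodes and powers of linear forms\<close>

text \<open>A pair with \<open>\<beta> j \<noteq> 0\<close> is the node
  \<open>\<alpha> j / \<beta> j\<close> with weight \<open>\<beta> j ^ d\<close>; a pair with
  \<open>\<beta> j = 0\<close> contributes only at \<open>k = d\<close>. Conversely,
  \<open>d\<close>-th roots absorb the weights.\<close>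

lemma power_sum_rep_iff_linear_powers:
  fixes a :: "nat \<Rightarrow> complex"
  assumes "d \<ge> 1"
  shows "power_sum_rep d a r \<longleftrightarrow> (\<exists>\<alpha> \<beta>. \<forall>k\<le>d. a k = (\<Sum>j<r. \<alpha> j ^ k * \<beta> j ^ (d - k)))"
proof
  assume "power_sum_rep d a r"
  then obtain Z c e where Z: "finite Z" "card Z + (if e = 0 then 0 else 1) \<le> r"
    and a: "\<And>k. k \<le> d \<Longrightarrow> a k = (\<Sum>z\<in>Z. c z * z ^ k) + (if k = d then e else 0)"
    unfolding power_sum_rep_def by blast
  obtain h where h: "bij_betw h {..<card Z} Z"
    using ex_bij_betw_nat_finite[OF Z(1)] by (auto simp: atLeast0LessThan)
  have "\<exists>z. z ^ d = w" for w :: complex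
  proof -
    have "degree (monom 1 d + [:- w:]) = d"
      using assms by (subst degree_add_eq_left) (auto simp: degree_monom_eq)
    then obtain z where "poly (monom 1 d + [:- w:]) z = 0"
      using fundamental_theorem_of_algebra[of "monom 1 d + [:- w:]"] assms
      by (metis constant_degree not_one_le_zero)
    then show ?thesis by (auto simp: poly_monom)
  qed
  then obtain \<rho> :: "complex \<Rightarrow> complex" where \<rho>: "\<And>w. \<rho> w ^ d = w" by metis
  \<comment> \<open>Index \<open>card Z\<close> carries the node at infinity, and later indices are
    zero fillers.\<close>
  define \<alpha> where "\<alpha> j = (if j < card Z then \<rho> (c (h j)) * h j
    else if j = card Z then \<rho> e else 0)" for j
  define \<beta> where "\<beta> j = (if j < card Z then \<rho> (c (h j)) else 0)" for j
  have "a k = (\<Sum>j<r. \<alpha> j ^ k * \<beta> j ^ (d - k))" if k: "k \<le> d" for k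
  proof -
    let ?t = "\<lambda>j. \<alpha> j ^ k * \<beta> j ^ (d - k)"
    have "(\<Sum>j<card Z. ?t j) = (\<Sum>j<card Z. c (h j) * h j ^ k)"
    proof (intro sum.cong refl)
      fix j assume "j \<in> {..<card Z}"
      then have "?t j = (\<rho> (c (h j)) ^ k * \<rho> (c (h j)) ^ (d - k)) * h j ^ k"
        by (simp add: \<alpha>_def \<beta>_def power_mult_distrib)
      then show "?t j = c (h j) * h j ^ k"
        using k by (simp add: \<rho> flip: power_add)
    qed
    also have "\<dots> = (\<Sum>z\<in>Z. c z * z ^ k)"
      using sum.reindex_bij_betw[OF h, of "\<lambda>z. c z * z ^ k"] by simp
    finally have 1: "(\<Sum>j<card Z. ?t j) = (\<Sum>z\<in>Z. c z * z ^ k)" .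
    have "(\<Sum>j\<in>{card Z..<r}. ?t j) =
        (\<Sum>j\<in>{card Z..<r}. if j = card Z then (if k = d then e else 0) else 0)"
    proof (intro sum.cong refl)
      fix j assume "j \<in> {card Z..<r}"
      then show "?t j = (if j = card Z then (if k = d then e else 0) else 0)"
        using k assms \<rho> by (auto simp: \<alpha>_def \<beta>_def power_0_left)
    qed
    also have "\<dots> = (if k = d then e else 0)"
      using Z(2) by (auto simp: sum.delta split: if_splits)
    finally have 2: "(\<Sum>j\<in>{card Z..<r}. ?t j) = (if k = d then e else 0)" .
    have "{..<r} = {..<card Z} \<union> {card Z..<r}" using Z(2) by (auto split: if_splits)
    then have "(\<Sum>j<r. ?t j) = (\<Sum>j<card Z. ?t j) + (\<Sum>j\<in>{card Z..<r}. ?t j)"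
      by (metis (no_types, lifting) finite_lessThan finite_atLeastLessThan sum.union_disjoint
          ivl_disj_int_one(2))
    then show ?thesis using a[OF k] 1 2 by simp
  qed
  then show "\<exists>\<alpha> \<beta>. \<forall>k\<le>d. a k = (\<Sum>j<r. \<alpha> j ^ k * \<beta> j ^ (d - k))" by blast
next
  assume "\<exists>\<alpha> \<beta>. \<forall>k\<le>d. a k = (\<Sum>j<r. \<alpha> j ^ k * \<beta> j ^ (d - k))"
  then obtain \<alpha> \<beta> where a: "\<And>k. k \<le> d \<Longrightarrow> a k = (\<Sum>j<r. \<alpha> j ^ k * \<beta> j ^ (d - k))" by blast
  define J where "J = {j. j < r \<and> \<beta> j \<noteq> 0}"
  define J0 where "J0 = {j. j < r \<and> \<beta> j = 0}"
  let ?h = "\<lambda>j. \<alpha> j / \<beta> j"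
  \<comment> \<open>Several pairs can give the same node, so weights are summed over each
    fibre.\<close>
  define c where "c z = (\<Sum>j | j \<in> J \<and> ?h j = z. \<beta> j ^ d)" for z
  define e where "e = (\<Sum>j\<in>J0. \<alpha> j ^ d)"
  have fin: "finite J" "finite J0" and disj: "J \<inter> J0 = {}" and un: "J \<union> J0 = {..<r}"
    by (auto simp: J_def J0_def)
  have "a k = (\<Sum>z\<in>?h ` J. c z * z ^ k) + (if k = d then e else 0)" if k: "k \<le> d" for k
  proof -
    let ?t = "\<lambda>j. \<alpha> j ^ k * \<beta> j ^ (d - k)"
    have "a k = (\<Sum>j\<in>J. ?t j) + (\<Sum>j\<in>J0. ?t j)"
      using a[OF k] sum.union_disjoint[OF fin disj, of ?t] un by simp
    also have "(\<Sum>j\<in>J0. ?t j) = (\<Sum>j\<in>J0. if k = d then \<alpha> j ^ d else 0)"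
      using k by (intro sum.cong) (auto simp: J0_def)
    also have "\<dots> = (if k = d then e else 0)" by (simp add: e_def)
    also have "(\<Sum>j\<in>J. ?t j) = (\<Sum>j\<in>J. \<beta> j ^ d * ?h j ^ k)"
      using k by (intro sum.cong) (auto simp: J_def power_divide power_diff)
    also have "\<dots> = (\<Sum>z\<in>?h ` J. \<Sum>j | j \<in> J \<and> ?h j = z. \<beta> j ^ d * ?h j ^ k)"
      by (rule sum.image_gen[OF fin(1)])
    also have "\<dots> = (\<Sum>z\<in>?h ` J. c z * z ^ k)"
      unfolding c_def sum_distrib_right by (intro sum.cong) auto
    finally show ?thesis .
  qed
  moreover have "card (?h ` J) + (if e = 0 then 0 else 1) \<le> r"
  proof -
    have "card J + card J0 = r"
      using card_Un_disjoint[OF fin disj] un by simp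
    moreover have "card (?h ` J) \<le> card J" by (rule card_image_le[OF fin(1)])
    moreover have "J0 \<noteq> {}" if "e \<noteq> 0" using that by (auto simp: e_def)
    then have "(if e = 0 then 0 else 1) \<le> card J0" using fin(2) by (auto simp: Suc_le_eq card_gt_0_iff)
    ultimately show ?thesis by linarith
  qed
  ultimately show "power_sum_rep d a r"
    unfolding power_sum_rep_def using fin(1) by blast
qed

subsection \<open>Apolarity and Waring decompositions of binary forms\<close>

text \<open>The linear functional with value \<open>b i j\<close> at the monomial with exponents
  \<open>i\<close> and \<open>j\<close>. For \<open>b\<close> the table of derivatives of
  \<open>f\<close> at the origin, it gives the constant term of \<open>q\<close> applied to
  \<open>f\<close>.\<close>

definition bipairing :: "(nat \<Rightarrow> nat \<Rightarrow> complex) \<Rightarrow> bipoly \<Rightarrow> complex" where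
  "bipairing b q = (\<Sum>i\<le>degree q. pairing (b i) (coeff q i))"

lemma bipairing_eq_sum:
  assumes "degree q \<le> n"
  shows "bipairing b q = (\<Sum>i\<le>n. pairing (b i) (coeff q i))"
  unfolding bipairing_def using assms
  by (intro sum.mono_neutral_left) (auto simp: coeff_eq_0)

lemma bipairing_add: "bipairing b (p + q) = bipairing b p + bipairing b q"
proof -
  let ?n = "max (degree p) (degree q)"
  have "degree (p + q) \<le> ?n" by (rule degree_add_le_max)
  then show ?thesis
    by (simp add: bipairing_eq_sum[of _ ?n] sum.distrib pairing_add)
qed

lemma bipairing_pCons: "bipairing b (pCons c q) = pairing (b 0) c + bipairing (\<lambda>i. b (Suc i)) q"
  by (simp add: bipairing_eq_sum[of "pCons c q" "Suc (degree q)"] degree_pCons_le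
      sum.atMost_Suc_shift bipairing_def del: sum.atMost_Suc)

lemma bipairing_smult_pCons:
  "bipairing b (smult (pCons x c) q) =
     x * bipairing b q + bipairing (\<lambda>i j. b i (Suc j)) (smult c q)"
  by (simp only: bipairing_eq_sum[OF degree_smult_le] bipairing_def[of b q])
    (simp add: sum_distrib_left pairing_add pairing_smult pairing_pCons flip: sum.distrib)

text \<open>Multiplication by a monomial shifts both indices of \<open>b\<close>; the two nested
  inductions peel off one variable each.\<close>

lemma bipairing_mult_eq_0:
  assumes "\<And>u v. bipairing (\<lambda>i j. b (u + i) (v + j)) q = 0"
  shows "bipairing b (p * q) = 0"
  using assms
proof (induction p arbitrary: b)
  case 0
  then show ?case by (simp add: bipairing_def)
next
  case (pCons c p)
  have "bipairing b (smult c q) = 0"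
    using pCons.prems
  proof (induction c arbitrary: b)
    case 0
    then show ?case by (simp add: bipairing_def)
  next
    case (pCons x c)
    have "bipairing (\<lambda>i j. b i (Suc j)) (smult c q) = 0"
      by (rule pCons.IH) (use pCons.prems[of _ "Suc _"] in simp)
    then show ?case using pCons.prems[of 0 0] by (simp add: bipairing_smult_pCons)
  qed
  moreover have "bipairing (\<lambda>i. b (Suc i)) (p * q) = 0"
    by (rule pCons.IH) (use pCons.prems[of "Suc _"] in simp)
  ultimately show ?case by (simp add: bipairing_add bipairing_pCons)
qed

lemma coeff_higher_partial_y: "coeff ((partial_y ^^ j) f) i = (pderiv ^^ j) (coeff f i)"
  by (induction j) (simp_all add: partial_y_def coeff_map_poly)

lemma coeff_higher_partials:
  "fact u * fact v * coeff (coeff ((partial_x ^^ i) ((partial_y ^^ j) f)) u) v =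
     fact (u + i) * fact (v + j) * coeff (coeff f (u + i)) (v + j)"
proof -
  have poch: "fact (n + m) = fact n * pochhammer (of_nat (Suc n) :: complex) m" for n m
    using pochhammer_product'[of "1::complex" n m]
    by (simp add: pochhammer_fact[symmetric] add.commute)
  have "partial_x = pderiv" by (rule ext) (simp add: partial_x_def)
  \<comment> \<open>The factor from \<open>coeff_higher_pderiv\<close> lives in the coefficient ring
    of the outer polynomial, so it is rewritten as a constant polynomial.\<close>
  moreover have "pochhammer (of_nat (Suc u)) i = ([:pochhammer (of_nat (Suc u)) i:] :: complex poly)"
    by (induction i) (simp_all add: pochhammer_Suc one_pCons of_nat_poly)
  ultimately have "coeff (coeff ((partial_x ^^ i) ((partial_y ^^ j) f)) u) v =
      pochhammer (of_nat (Suc u)) i * (pochhammer (of_nat (Suc v)) j * coeff (coeff f (u + i)) (v + j))"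
    by (simp only: coeff_higher_pderiv coeff_higher_partial_y)
      (simp add: coeff_higher_pderiv)
  then show ?thesis by (simp only: poch[of u i] poch[of v j] mult_ac)
qed

lemma coeff_diff_action:
  "fact u * fact v * coeff (coeff (diff_action q f) u) v =
     bipairing (\<lambda>i j. fact (u + i) * fact (v + j) * coeff (coeff f (u + i)) (v + j)) q"
  unfolding diff_action_def bipairing_def pairing_def
  by (simp add: coeff_sum sum_distrib_left mult.left_commute[of _ "coeff (coeff q _) _"]
      coeff_higher_partials)

lemma principal_ideal_subset_apolar_ideal_iff:
  "principal_ideal g \<subseteq> apolar_ideal f \<longleftrightarrow>
    (\<forall>u v. bipairing (\<lambda>i j. fact (u + i) * fact (v + j) * coeff (coeff f (u + i)) (v + j)) g = 0)"
  (is "_ \<longleftrightarrow> (\<forall>u v. bipairing (?b u v) g = 0)")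
proof
  assume "principal_ideal g \<subseteq> apolar_ideal f"
  moreover have "g \<in> principal_ideal g"
    unfolding principal_ideal_def by (intro CollectI exI[of _ 1]) simp
  ultimately have "diff_action g f = 0" by (auto simp: apolar_ideal_def)
  then show "\<forall>u v. bipairing (?b u v) g = 0" by (simp flip: coeff_diff_action)
next
  assume b: "\<forall>u v. bipairing (?b u v) g = 0"
  have "diff_action (p * g) f = 0" for p
  proof (intro poly_eqI)
    fix u v
    have "bipairing (?b u v) (p * g) = 0"
      by (rule bipairing_mult_eq_0) (use b in \<open>simp add: add.assoc[symmetric]\<close>)
    then show "coeff (coeff (diff_action (p * g) f) u) v = coeff (coeff 0 u) v"
      by (simp flip: coeff_diff_action)
  qed
  then show "principal_ideal g \<subseteq> apolar_ideal f"
    by (auto simp: principal_ideal_def apolar_ideal_def)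
qed

section \<open>Passage between forms and univariate polynomials\<close>

text \<open>Sets \<open>Y = 1\<close> in a form of degree \<open>n\<close>; \<open>n\<close> is
  explicit because zeros at infinity lower the degree of the result.\<close>

definition dehomogenize :: "nat \<Rightarrow> bipoly \<Rightarrow> complex poly" where
  "dehomogenize n g = (\<Sum>i\<le>n. monom (coeff (coeff g i) (n - i)) i)"

definition homogenize :: "nat \<Rightarrow> complex poly \<Rightarrow> bipoly" where
  "homogenize n p = (\<Sum>i\<le>n. monom (monom (coeff p i) (n - i)) i)"

lemma coeff_dehomogenize:
  "coeff (dehomogenize n g) i = (if i \<le> n then coeff (coeff g i) (n - i) else 0)"
  by (auto simp: dehomogenize_def coeff_sum coeff_monom sum.delta)

lemma coeff_homogenize:
  "coeff (coeff (homogenize n p) i) j = (if i + j = n then coeff p i else 0)"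
proof -
  have "coeff (homogenize n p) i = (if i \<le> n then monom (coeff p i) (n - i) else 0)"
    by (auto simp: homogenize_def coeff_sum coeff_monom sum.delta)
  then show ?thesis by (auto simp: coeff_monom)
qed

lemma homogeneous_homogenize: "homogeneous n (homogenize n p)"
  by (simp add: homogeneous_def coeff_homogenize)

lemma degree_dehomogenize: "degree (dehomogenize n g) \<le> n"
  by (rule degree_le) (simp add: coeff_dehomogenize)

lemma dehomogenize_homogenize:
  assumes "degree p \<le> n"
  shows "dehomogenize n (homogenize n p) = p"
  using assms by (intro poly_eqI) (auto simp: coeff_dehomogenize coeff_homogenize coeff_eq_0)

lemma homogenize_dehomogenize:
  assumes "homogeneous n g"
  shows "homogenize n (dehomogenize n g) = g"
  using assms by (intro poly_eqI) (auto simp: coeff_dehomogenize coeff_homogenize homogeneous_def)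

text \<open>Both supports are antidiagonals, and a shift by \<open>u\<close> and \<open>v\<close>
  makes them meet only if \<open>u + v + n = d\<close>.\<close>

lemma bipairing_homogeneous:
  assumes "homogeneous n g"
    and b: "\<And>i j. i + j \<noteq> d \<Longrightarrow> b i j = 0"
  shows "bipairing (\<lambda>i j. b (u + i) (v + j)) g =
    (if u + v + n = d then pairing (\<lambda>i. b (u + i) (d - (u + i))) (dehomogenize n g) else 0)"
proof -
  have "coeff (coeff g i) j = 0" if "i > n \<or> j > n" for i j
    using assms(1) that unfolding homogeneous_def by fastforce
  then have "degree g \<le> n" "\<And>i. degree (coeff g i) \<le> n"
    by (auto intro!: degree_le poly_eqI)
  then have "bipairing (\<lambda>i j. b (u + i) (v + j)) g =
      (\<Sum>i\<le>n. \<Sum>j\<le>n. coeff (coeff g i) j * b (u + i) (v + j))"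
    by (simp add: bipairing_eq_sum[of _ n] pairing_eq_sum[of _ n])
  also have "\<dots> = (\<Sum>i\<le>n. coeff (coeff g i) (n - i) * b (u + i) (v + (n - i)))"
  proof (intro sum.cong refl)
    fix i assume "i \<in> {..n}"
    have "(\<Sum>j\<le>n. coeff (coeff g i) j * b (u + i) (v + j)) =
        (\<Sum>j\<in>{n - i}. coeff (coeff g i) j * b (u + i) (v + j))"
      using assms(1) unfolding homogeneous_def
      by (intro sum.mono_neutral_right) (auto, metis diff_add_inverse)
    then show "(\<Sum>j\<le>n. coeff (coeff g i) j * b (u + i) (v + j)) =
        coeff (coeff g i) (n - i) * b (u + i) (v + (n - i))" by simp
  qed
  also have "\<dots> = (\<Sum>i\<le>n. if u + v + n = d
      then coeff (dehomogenize n g) i * b (u + i) (d - (u + i)) else 0)"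
    by (intro sum.cong refl) (auto simp: coeff_dehomogenize b algebra_simps)
  also have "\<dots> = (if u + v + n = d
      then pairing (\<lambda>i. b (u + i) (d - (u + i))) (dehomogenize n g) else 0)"
    by (simp add: pairing_eq_sum[OF degree_dehomogenize])
  finally show ?thesis .
qed

text \<open>Dividing by the binomials turns the coefficients of a \<open>d\<close>-th power of a
  linear form into \<open>\<alpha> ^ k * \<beta> ^ (d - k)\<close>.\<close>

definition normalized_coeff :: "nat \<Rightarrow> bipoly \<Rightarrow> nat \<Rightarrow> complex" where
  "normalized_coeff d f k = coeff (coeff f k) (d - k) / of_nat (d choose k)"

text \<open>Derivatives of \<open>f\<close> at the origin are \<open>fact d\<close> times normalized
  coefficients. Only pairs with \<open>u + v + n = d\<close> give a condition, so \<open>u\<close>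
  ranges over \<open>u + n \<le> d\<close> and determines \<open>v\<close>.\<close>

lemma principal_ideal_subset_apolar_ideal_iff_hankel_kernel:
  assumes f: "homogeneous d f" and g: "homogeneous n g"
  shows "principal_ideal g \<subseteq> apolar_ideal f \<longleftrightarrow>
    dehomogenize n g \<in> hankel_kernel d (normalized_coeff d f) n"
proof -
  let ?b = "\<lambda>i j. fact i * fact j * coeff (coeff f i) j"
  have b0: "?b i j = 0" if "i + j \<noteq> d" for i j
    using f that by (auto simp: homogeneous_def)
  have b: "?b k (d - k) = fact d * normalized_coeff d f k" if "k \<le> d" for k
    using that binomial_fact[of k d, where 'a = complex]
    by (simp add: normalized_coeff_def field_simps)
  have *: "pairing (\<lambda>i. ?b (u + i) (d - (u + i))) (dehomogenize n g) =
      fact d * pairing (\<lambda>i. normalized_coeff d f (u + i)) (dehomogenize n g)"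
    if "u + n \<le> d" for u
  proof -
    have "?b (u + i) (d - (u + i)) = fact d * normalized_coeff d f (u + i)" if "i \<le> n" for i
      using \<open>u + n \<le> d\<close> that by (intro b) simp
    then show ?thesis
      by (simp add: pairing_eq_sum[OF degree_dehomogenize] sum_distrib_left mult_ac)
  qed
  have bipairing: "bipairing (\<lambda>i j. ?b (u + i) (v + j)) g =
      (if u + v + n = d
       then pairing (\<lambda>i. ?b (u + i) (d - (u + i))) (dehomogenize n g) else 0)" for u v
    by (rule bipairing_homogeneous[where b = ?b]) (use g b0 in auto)
  have "principal_ideal g \<subseteq> apolar_ideal f \<longleftrightarrow> (\<forall>u v. u + v + n = d \<longrightarrow>
      pairing (\<lambda>i. ?b (u + i) (d - (u + i))) (dehomogenize n g) = 0)"
    unfolding principal_ideal_subset_apolar_ideal_iff using bipairing by auto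
  also have "\<dots> \<longleftrightarrow> (\<forall>u. u + n \<le> d \<longrightarrow>
      pairing (\<lambda>i. normalized_coeff d f (u + i)) (dehomogenize n g) = 0)"
  proof (intro iffI allI impI)
    fix u assume eq: "\<forall>u v. u + v + n = d \<longrightarrow>
      pairing (\<lambda>i. ?b (u + i) (d - (u + i))) (dehomogenize n g) = 0" and u: "u + n \<le> d"
    from u have "u + (d - n - u) + n = d" by simp
    from eq[rule_format, OF this]
    show "pairing (\<lambda>i. normalized_coeff d f (u + i)) (dehomogenize n g) = 0"
      unfolding *[OF u] by simp
  qed (use * in auto)
  finally show ?thesis using degree_dehomogenize by (simp add: hankel_kernel_def)
qed

lemma cactus_rank_eq_Least_hankel_kernel:
  assumes "homogeneous d f"
  shows "cactus_rank f = (LEAST n. \<exists>p\<in>hankel_kernel d (normalized_coeff d f) n. p \<noteq> 0)"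
proof -
  have "(\<exists>g. g \<noteq> 0 \<and> homogeneous n g \<and> principal_ideal g \<subseteq> apolar_ideal f) \<longleftrightarrow>
      (\<exists>p\<in>hankel_kernel d (normalized_coeff d f) n. p \<noteq> 0)" for n
  proof
    assume "\<exists>g. g \<noteq> 0 \<and> homogeneous n g \<and> principal_ideal g \<subseteq> apolar_ideal f"
    then obtain g where g: "g \<noteq> 0" "homogeneous n g" "principal_ideal g \<subseteq> apolar_ideal f"
      by blast
    have "dehomogenize n g \<noteq> 0"
      using g(1) homogenize_dehomogenize[OF g(2)] by (auto simp: homogenize_def)
    then show "\<exists>p\<in>hankel_kernel d (normalized_coeff d f) n. p \<noteq> 0"
      using g(3) principal_ideal_subset_apolar_ideal_iff_hankel_kernel[OF assms g(2)] by blast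
  next
    assume "\<exists>p\<in>hankel_kernel d (normalized_coeff d f) n. p \<noteq> 0"
    then obtain p where p: "p \<in> hankel_kernel d (normalized_coeff d f) n" "p \<noteq> 0" by blast
    then have dehom: "dehomogenize n (homogenize n p) = p"
      by (intro dehomogenize_homogenize) (simp add: hankel_kernel_def)
    then have "homogenize n p \<noteq> 0" using p(2) by (auto simp: dehomogenize_def)
    then show "\<exists>g. g \<noteq> 0 \<and> homogeneous n g \<and> principal_ideal g \<subseteq> apolar_ideal f"
      using p(1) dehom homogeneous_homogenize[of n p]
        principal_ideal_subset_apolar_ideal_iff_hankel_kernel[OF assms homogeneous_homogenize, of n p]
      by (intro exI[of _ "homogenize n p"]) simp
  qed
  then show ?thesis by (simp add: cactus_rank_def)
qed

section \<open>Waring decompositions in coordinates\<close>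

text \<open>The binomial theorem for the linear form with coefficient \<open>\<alpha>\<close> at
  \<open>x\<close> and \<open>\<beta>\<close> at \<open>y\<close>.\<close>

lemma homogenize_linear_power:
  "homogenize 1 [:\<beta>, \<alpha>:] ^ d =
     (\<Sum>k\<le>d. monom (monom (of_nat (d choose k) * (\<alpha> ^ k * \<beta> ^ (d - k))) (d - k)) k)"
proof -
  have "homogenize 1 [:\<beta>, \<alpha>:] = monom (monom \<alpha> 0) 1 + monom (monom \<beta> 1) 0"
    by (simp add: homogenize_def)
  then have "homogenize 1 [:\<beta>, \<alpha>:] ^ d =
      (\<Sum>k\<le>d. of_nat (d choose k) * monom (monom \<alpha> 0) 1 ^ k * monom (monom \<beta> 1) 0 ^ (d - k))"
    by (simp only: binomial_ring)
  also have "\<dots> = (\<Sum>k\<le>d. monom (monom (of_nat (d choose k) * (\<alpha> ^ k * \<beta> ^ (d - k))) (d - k)) k)"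
    by (intro sum.cong refl)
      (simp add: monom_power mult_monom of_nat_poly smult_monom mult.assoc)
  finally show ?thesis .
qed

lemma coeff_homogenize_linear_power:
  "coeff (coeff (homogenize 1 [:\<beta>, \<alpha>:] ^ d) i) j =
     (if i + j = d then of_nat (d choose i) * (\<alpha> ^ i * \<beta> ^ (d - i)) else 0)"
proof -
  have "coeff (homogenize 1 [:\<beta>, \<alpha>:] ^ d) i =
      (if i \<le> d then monom (of_nat (d choose i) * (\<alpha> ^ i * \<beta> ^ (d - i))) (d - i) else 0)"
    unfolding homogenize_linear_power by (auto simp: coeff_sum coeff_monom sum.delta)
  then show ?thesis by (auto simp: coeff_monom)
qed

lemma sum_linear_powers_iff:
  assumes "homogeneous d f"
  shows "f = (\<Sum>j<r. homogenize 1 [:\<beta> j, \<alpha> j:] ^ d) \<longleftrightarrow>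
    (\<forall>k\<le>d. normalized_coeff d f k = (\<Sum>j<r. \<alpha> j ^ k * \<beta> j ^ (d - k)))"
proof -
  let ?s = "\<lambda>k. \<Sum>j<r. \<alpha> j ^ k * \<beta> j ^ (d - k)"
  have coeff: "coeff (coeff (\<Sum>j<r. homogenize 1 [:\<beta> j, \<alpha> j:] ^ d) i) j =
      (if i + j = d then of_nat (d choose i) * ?s i else 0)" for i j
    unfolding coeff_sum coeff_homogenize_linear_power by (simp add: sum_distrib_left)
  have "f = (\<Sum>j<r. homogenize 1 [:\<beta> j, \<alpha> j:] ^ d) \<longleftrightarrow>
      (\<forall>i j. coeff (coeff f i) j = (if i + j = d then of_nat (d choose i) * ?s i else 0))"
    unfolding poly_eq_iff coeff ..
  also have "\<dots> \<longleftrightarrow> (\<forall>k\<le>d. coeff (coeff f k) (d - k) = of_nat (d choose k) * ?s k)"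
  proof (intro iffI allI impI)
    fix i j
    assume f: "\<forall>k\<le>d. coeff (coeff f k) (d - k) = of_nat (d choose k) * ?s k"
    show "coeff (coeff f i) j = (if i + j = d then of_nat (d choose i) * ?s i else 0)"
    proof (cases "i + j = d")
      case True
      then have "i \<le> d" "d - i = j" by auto
      then show ?thesis using f[rule_format, of i] True by simp
    next
      case False
      then show ?thesis using assms by (auto simp: homogeneous_def)
    qed
  qed simp
  also have "\<dots> \<longleftrightarrow> (\<forall>k\<le>d. normalized_coeff d f k = ?s k)"
    by (auto simp: normalized_coeff_def field_simps)
  finally show ?thesis .
qed

lemma waring_rank_eq_Least_power_sum_rep:
  assumes "d \<ge> 1" "homogeneous d f"
  shows "waring_rank d f = (LEAST r. power_sum_rep d (normalized_coeff d f) r)"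
proof -
  have "(\<exists>l. (\<forall>j<r. homogeneous 1 (l j)) \<and> f = (\<Sum>j<r. l j ^ d)) \<longleftrightarrow>
      power_sum_rep d (normalized_coeff d f) r" for r
  proof
    assume "\<exists>l. (\<forall>j<r. homogeneous 1 (l j)) \<and> f = (\<Sum>j<r. l j ^ d)"
    then obtain l where l: "\<And>j. j < r \<Longrightarrow> homogeneous 1 (l j)" "f = (\<Sum>j<r. l j ^ d)" by blast
    let ?\<alpha> = "\<lambda>j. coeff (dehomogenize 1 (l j)) 1" and ?\<beta> = "\<lambda>j. coeff (dehomogenize 1 (l j)) 0"
    have "[:?\<beta> j, ?\<alpha> j:] = dehomogenize 1 (l j)" for j
      by (rule poly_eqI) (auto simp: coeff_pCons coeff_dehomogenize split: nat.splits)
    then have "homogenize 1 [:?\<beta> j, ?\<alpha> j:] = l j" if "j < r" for j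
      using homogenize_dehomogenize[OF l(1)[OF that]] by simp
    then have "f = (\<Sum>j<r. homogenize 1 [:?\<beta> j, ?\<alpha> j:] ^ d)" using l(2) by simp
    then show "power_sum_rep d (normalized_coeff d f) r"
      unfolding power_sum_rep_iff_linear_powers[OF assms(1)] sum_linear_powers_iff[OF assms(2)]
      by (intro exI[of _ ?\<alpha>] exI[of _ ?\<beta>])
  next
    assume "power_sum_rep d (normalized_coeff d f) r"
    then obtain \<alpha> \<beta> where "f = (\<Sum>j<r. homogenize 1 [:\<beta> j, \<alpha> j:] ^ d)"
      unfolding power_sum_rep_iff_linear_powers[OF assms(1)] sum_linear_powers_iff[OF assms(2)]
      by blast
    then show "\<exists>l. (\<forall>j<r. homogeneous 1 (l j)) \<and> f = (\<Sum>j<r. l j ^ d)"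
      using homogeneous_homogenize by (intro exI[of _ "\<lambda>j. homogenize 1 [:\<beta> j, \<alpha> j:]"]) auto
  qed
  then show ?thesis by (simp add: waring_rank_def)
qed

theorem corollary2p5:
  fixes f :: bipoly and d :: nat
  assumes "d \<ge> 1" and "homogeneous d f" and "f \<noteq> 0"
  shows "(real (waring_rank d f) \<le> (real d + 2) / 2 \<longrightarrow> cactus_rank f = waring_rank d f) \<and>
         (real (waring_rank d f) > (real d + 2) / 2 \<longrightarrow>
            int (cactus_rank f) = int d + 2 - int (waring_rank d f))"
proof -
  obtain i j where ij: "coeff (coeff f i) j \<noteq> 0"
    using assms(3) by (metis coeff_0 poly_eqI)
  then have "i + j = d" using assms(2) by (simp add: homogeneous_def)
  with ij have "i \<le> d" "normalized_coeff d f i \<noteq> 0" by (auto simp: normalized_coeff_def)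
  from least_hankel_kernel_and_power_sum_rep[where a = "normalized_coeff d f", OF assms(1) this]
  have "2 * cactus_rank f \<le> d + 2 \<and>
      (waring_rank d f = cactus_rank f \<or> waring_rank d f + cactus_rank f = d + 2)"
    unfolding cactus_rank_eq_Least_hankel_kernel[OF assms(2)]
      waring_rank_eq_Least_power_sum_rep[OF assms(1,2)] .
  \<comment> \<open>If the ranks add up to \<open>d + 2\<close>, the bound on the cactus rank forces
    the Waring rank to be at least \<open>(d + 2) / 2\<close>, with equality only if both agree; if
    they are equal, it is at most \<open>(d + 2) / 2\<close>.\<close>
  then show ?thesis by auto
qed

end
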